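(* Let $n \in \mathbb{N}$ with $n\ge 1$ and let $\mathbb{K}$ be a non-Archimedean valued field with valuation $|\cdot|$. Let $r_1, \dots, r_n\in \mathbb{K}$ be such that $\sum_{j=1}^{n}r_j=1$. Let $(a_j)_{j=1}^n, (b_j)_{j=1}^n \in \mathbb{K}^n$. Then $$\left|\sum_{j=1}^{n}r_ja_j\right|\left|\sum_{k=1}^{n}r_kb_k\right|\leq \max\left\{\left|\sum_{j=1}^{n}r_ja_jb_j\right|,\ \max_{1\leq j < k \leq n}|r_j||r_k||a_j-a_k||b_j-b_k|\right\}.$$
   Context: A non-Archimedean valued field is a field $\mathbb{K}$ with a map $|\cdot|:\mathbb{K}\to[0,\infty)$ such that (i) $|\lambda|=0$ if and only if $\lambda=0$; (ii) $|\lambda\mu|=|\lambda||\mu|$ for all $\lambda,\mu\in\mathbb{K}$; (iii) $|\lambda+\mu|\leq\max\{|\lambda|,|\mu|\}$ for all $\lambda,\mu\in\mathbb{K}$. For $n=1$ the maximum over the empty set of pairs $j<k$ is taken to be $0$. *)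

theory Defs
  imports Complex_Main
begin

locale nonarchimedean_valuation =
  fixes v :: "'a::field \<Rightarrow> real"
  assumes nonneg: "0 \<le> v x"
    and eq_0_iff: "v x = 0 \<longleftrightarrow> x = 0"
    and mult: "v (x * y) = v x * v y"
    and add_le_max: "v (x + y) \<le> max (v x) (v y)"

(* The maximum of a finite set of reals, with the convention that the empty
   maximum is 0; Max alone is unspecified on the empty set. *)
definition Max0 :: "real set \<Rightarrow> real" where
  "Max0 S = (if S = {} then 0 else Max S)"

end

theory Submission
  imports Defs
begin

text \<open>
  The inequality is the ultrametric reading of Korkine's identity. Over any commutative ring,
  \<open>(\<Sum>j. r j) * (\<Sum>j. r j * a j * b j) - (\<Sum>j. r j * a j) * (\<Sum>k. r k * b k)\<close> is the sum of
  \<open>r j * r k * (a j - a k) * (b j - b k)\<close> over the pairs \<open>j < k\<close>. When the weights \<open>r j\<close> sum to 1,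
  this writes the product of the two weighted means as the weighted mean of the products minus
  the pair terms. The strong triangle inequality then bounds its valuation by the largest
  valuation among these summands, and multiplicativity splits the valuation of each pair term into
  its four factors.
\<close>

text \<open>
  Summing over all ordered pairs would give twice this identity, and 2 may vanish in the field.
  Induction on \<open>n\<close> over the pairs \<open>j < k\<close> avoids the division: the terms in which the new index
  is paired with an earlier one are exactly what the two products gain.
\<close>
lemma korkine_identity:
  fixes r a b :: "nat \<Rightarrow> 'a::comm_ring_1"
  shows "(\<Sum>j=1..n. r j) * (\<Sum>j=1..n. r j * a j * b j) =
    (\<Sum>j=1..n. r j * a j) * (\<Sum>j=1..n. r j * b j)
    + (\<Sum>k=1..n. \<Sum>j=1..<k. r j * r k * (a j - a k) * (b j - b k))"
proof (induction n)
  case 0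
  show ?case by simp
next
  case (Suc n)
  let ?m = "Suc n"
  have "(\<Sum>j=1..n. r j * r ?m * (a j - a ?m) * (b j - b ?m)) =
    (\<Sum>j=1..n. r ?m * (r j * a j * b j) + r ?m * a ?m * b ?m * r j
      - r ?m * b ?m * (r j * a j) - r ?m * a ?m * (r j * b j))"
    by (rule sum.cong) (simp_all add: algebra_simps)
  also have "\<dots> = r ?m * (\<Sum>j=1..n. r j * a j * b j) + r ?m * a ?m * b ?m * (\<Sum>j=1..n. r j)
      - r ?m * b ?m * (\<Sum>j=1..n. r j * a j) - r ?m * a ?m * (\<Sum>j=1..n. r j * b j)"
    by (simp only: sum.distrib sum_subtractf sum_distrib_left)
  finally show ?case
    using Suc.IH by (simp add: atLeastLessThanSuc_atLeastAtMost algebra_simps)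
qed

context nonarchimedean_valuation
begin

lemma valuation_minus: "v (- x) = v x"
proof -
  have "(v (- x))\<^sup>2 = (v x)\<^sup>2"
    using mult[of "- x" "- x"] mult[of x x] by (simp add: power2_eq_square)
  then show ?thesis
    using nonneg by (simp add: power2_eq_iff_nonneg)
qed

lemma valuation_diff_le_max: "v (x - y) \<le> max (v x) (v y)"
  using add_le_max[of x "- y"] by (simp add: valuation_minus)

text \<open>
  The ultrametric inequality for finite sums, stated with an upper bound \<open>c\<close> instead of a maximum
  so that it applies to the empty sum and can be nested.
\<close>
lemma valuation_sum_le:
  assumes "0 \<le> c" and "\<And>i. i \<in> S \<Longrightarrow> v (f i) \<le> c"
  shows "v (\<Sum>i\<in>S. f i) \<le> c"
  using assms(2)
proof (induction S rule: infinite_finite_induct)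
  case (insert i S)
  then have "max (v (f i)) (v (\<Sum>i\<in>S. f i)) \<le> c"
    by simp
  then show ?case
    using insert.hyps order_trans[OF add_le_max[of "f i" "\<Sum>i\<in>S. f i"]] by simp
qed (use \<open>0 \<le> c\<close> eq_0_iff[of 0] in auto)

end

lemma Max0_upper: "finite S \<Longrightarrow> x \<in> S \<Longrightarrow> x \<le> Max0 S"
  by (auto simp: Max0_def)

lemma Max0_nonneg:
  assumes "finite S" and "\<And>x. x \<in> S \<Longrightarrow> 0 \<le> x"
  shows "0 \<le> Max0 S"
  using assms by (auto simp: Max0_def)

theorem theorem2p6:
  fixes v :: "'a::field \<Rightarrow> real" and n :: nat and r a b :: "nat \<Rightarrow> 'a"
  assumes "nonarchimedean_valuation v"
    and "n \<ge> 1"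
    and "(\<Sum>j=1..n. r j) = 1"
  shows "v (\<Sum>j=1..n. r j * a j) * v (\<Sum>k=1..n. r k * b k)
    \<le> max (v (\<Sum>j=1..n. r j * a j * b j))
        (Max0 {v (r j) * v (r k) * v (a j - a k) * v (b j - b k) | j k. 1 \<le> j \<and> j < k \<and> k \<le> n})"
proof -
  interpret nonarchimedean_valuation v by (rule assms(1))
  define pair_term where "pair_term j k = r j * r k * (a j - a k) * (b j - b k)" for j k
  define S where "S = {v (r j) * v (r k) * v (a j - a k) * v (b j - b k) | j k.
    1 \<le> j \<and> j < k \<and> k \<le> n}"
  let ?T = "\<Sum>j=1..n. r j * a j * b j"
  let ?D = "\<Sum>k=1..n. \<Sum>j=1..<k. pair_term j k"
  have "S \<subseteq> (\<lambda>(j, k). v (r j) * v (r k) * v (a j - a k) * v (b j - b k)) ` ({1..n} \<times> {1..n})"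
    unfolding S_def by force
  then have "finite S"
    by (rule finite_subset) simp
  have "v (pair_term j k) \<le> Max0 S" if "k \<in> {1..n}" "j \<in> {1..<k}" for j k
    using that by (intro Max0_upper[OF \<open>finite S\<close>]) (auto simp: S_def pair_term_def mult)
  moreover have "0 \<le> Max0 S"
    using \<open>finite S\<close> by (rule Max0_nonneg) (auto simp: S_def nonneg)
  ultimately have D: "v ?D \<le> Max0 S"
    by (intro valuation_sum_le)
  have "(\<Sum>j=1..n. r j * a j) * (\<Sum>k=1..n. r k * b k) = ?T - ?D"
    using korkine_identity[of r n a b] assms(3) by (simp add: pair_term_def)
  then have "v (\<Sum>j=1..n. r j * a j) * v (\<Sum>k=1..n. r k * b k) = v (?T - ?D)"
    by (simp flip: mult)
  also have "\<dots> \<le> max (v ?T) (v ?D)"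
    by (rule valuation_diff_le_max)
  also have "\<dots> \<le> max (v ?T) (Max0 S)"
    using D by simp
  finally show ?thesis
    unfolding S_def .
qed

end
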